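(* Let $x_0 \in \mathbb{R}^n$ and $\gamma > 0$. The data $(U_-,X)$ are informative for suboptimal linear quadratic regulation if and only if there exist a matrix $P = P^\top > 0$ and a right inverse $X_-^\dagger$ of $X_-$ such that $$(X_+X_-^\dagger)^\top P X_+X_-^\dagger - P + Q + (U_- X_-^\dagger)^\top R\, U_- X_-^\dagger < 0 \quad\text{and}\quad x_0^\top P x_0 < \gamma. \qquad ( * )$$ Moreover, a matrix $K\in\mathbb{R}^{m\times n}$ is a suboptimal feedback gain for all systems $(A,B) \in \Sigma_{\mathrm{i/s}}$ if and only if it is of the form $K = U_- X_-^\dagger$ for some right inverse $X_-^\dagger$ of $X_-$ satisfying $( * )$ (for some $P = P^\top > 0$).
   Context: All matrices are real. For symmetric matrices, $M>0$ ($M<0$, $M\ge 0$) means positive definite (negative definite, positive semidefinite). A square matrix is stable if all its eigenvalues lie in the open unit disk. A right inverse of $X_-\in\mathbb{R}^{n\times T}$ is a matrix $X_-^\dagger \in\mathbb{R}^{T\times n}$ with $X_-X_-^\dagger = I$. Data. There is a fixed unknown system $x(t+1) = A_s x(t) + B_s u(t)$ with $A_s\in\mathbb{R}^{n\times n}$, $B_s\in\mathbb{R}^{n\times m}$. From it one has measured $U_- = [u(0)\ u(1)\ \cdots\ u(T-1)]\in\mathbb{R}^{m\times T}$ and $X=[x(0)\ x(1)\ \cdots\ x(T)]\in\mathbb{R}^{n\times (T+1)}$, and one sets $X_- = [x(0)\ \cdots\ x(T-1)]$, $X_+ = [x(1)\ \cdots\ x(T)]$. Thus $X_+ = A_sX_-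 + B_sU_-$. The set of systems explaining the data is $$\Sigma_{\mathrm{i/s}} = \{(A,B)\in\mathbb{R}^{n\times n}\times\mathbb{R}^{n\times m} \mid X_+ = AX_- + BU_-\}.$$ Cost. Given are $Q=Q^\top\ge 0$ in $\mathbb{R}^{n\times n}$ and $R=R^\top>0$ in $\mathbb{R}^{m\times m}$. For a system $(A,B)$, initial state $x_0$ (not necessarily equal to the first sample $x(0)$ of the data) and gain $K$, let $J(x_0,K)=\sum_{t=0}^\infty \left(x(t)^\top Q x(t) + u(t)^\top R u(t)\right)$, where $x(\cdot)$ here denotes the closed-loop trajectory $x(t+1)=(A+BK)x(t)$ starting at $x_0$ and $u(t)=Kx(t)$. Given $x_0$ and $\gamma>0$, $K\in\mathbb{R}^{m\times n}$ is a suboptimal feedback gain for $(A,B)$ if $A+BK$ is stable and $J(x_0,K)<\gamma$. Informativity. The data $(U_-,X)$ are informative for suboptimal linear quadratic regulation (for given $x_0,\gamma$) if there exists a single matrix $K$ that is a suboptimal feedback gain for all $(A,B)\in\Sigma_{\mathrm{i/s}}$. *)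

theory Defs
  imports "Jordan_Normal_Form.Spectral_Radius" "HOL-Library.Extended_Real"
begin

definition symmetric_matrix :: "nat \<Rightarrow> real mat \<Rightarrow> bool" where
  "symmetric_matrix n M \<longleftrightarrow> M \<in> carrier_mat n n \<and> transpose_mat M = M"

definition positive_definite :: "nat \<Rightarrow> real mat \<Rightarrow> bool" where
  "positive_definite n M \<longleftrightarrow> symmetric_matrix n M \<and>
     (\<forall>v \<in> carrier_vec n. v \<noteq> 0\<^sub>v n \<longrightarrow> 0 < v \<bullet> (M *\<^sub>v v))"

definition positive_semidefinite :: "nat \<Rightarrow> real mat \<Rightarrow> bool" where
  "positive_semidefinite n M \<longleftrightarrow> symmetric_matrix n M \<and>
     (\<forall>v \<in> carrier_vec n. 0 \<le> v \<bullet> (M *\<^sub>v v))"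

definition negative_definite :: "nat \<Rightarrow> real mat \<Rightarrow> bool" where
  "negative_definite n M \<longleftrightarrow> symmetric_matrix n M \<and>
     (\<forall>v \<in> carrier_vec n. v \<noteq> 0\<^sub>v n \<longrightarrow> v \<bullet> (M *\<^sub>v v) < 0)"

text \<open>The embedding into complex matrices makes the condition range over all
  complex eigenvalues of the real matrix, not only over the real ones.\<close>

definition stable :: "real mat \<Rightarrow> bool" where
  "stable M \<longleftrightarrow> (\<forall>z. eigenvalue (map_mat complex_of_real M) z \<longrightarrow> cmod z < 1)"

definition right_inverse_mat :: "real mat \<Rightarrow> real mat \<Rightarrow> bool" where
  "right_inverse_mat M N \<longleftrightarrow> N \<in> carrier_mat (dim_col M) (dim_row M) \<and> inverts_mat M N"

definition input_data :: "nat \<Rightarrow> nat \<Rightarrow> (nat \<Rightarrow> real vec) \<Rightarrow> real mat" where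
  "input_data m T u = mat_of_cols m (map u [0..<T])"

definition state_data :: "nat \<Rightarrow> nat \<Rightarrow> (nat \<Rightarrow> real vec) \<Rightarrow> real mat" where
  "state_data n T x = mat_of_cols n (map x [0..<T + 1])"

text \<open>\<open>X\<^sub>-\<close> and \<open>X\<^sub>+\<close>: the state data without its last and without its first column.\<close>

definition past_states :: "real mat \<Rightarrow> real mat" where
  "past_states X = mat (dim_row X) (dim_col X - 1) (\<lambda>(i, j). X $$ (i, j))"

definition future_states :: "real mat \<Rightarrow> real mat" where
  "future_states X = mat (dim_row X) (dim_col X - 1) (\<lambda>(i, j). X $$ (i, j + 1))"

text \<open>The set \<open>\<Sigma>\<close> of systems that explain the data \<open>(U, X)\<close>; the dimensions
  are read off from the data matrices.\<close>

definition explaining_systems :: "real mat \<Rightarrow> real mat \<Rightarrow> (real mat \<times> real mat) set" where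
  "explaining_systems U X =
     {(A, B). A \<in> carrier_mat (dim_row X) (dim_row X) \<and> B \<in> carrier_mat (dim_row X) (dim_row U) \<and>
        future_states X = A * past_states X + B * U}"

primrec closed_loop :: "real mat \<Rightarrow> real mat \<Rightarrow> real mat \<Rightarrow> real vec \<Rightarrow> nat \<Rightarrow> real vec" where
  "closed_loop A B K x\<^sub>0 0 = x\<^sub>0"
| "closed_loop A B K x\<^sub>0 (Suc t) = (A + B * K) *\<^sub>v closed_loop A B K x\<^sub>0 t"

text \<open>The cost is extended-real valued: for positive semidefinite weights its terms are
  nonnegative, so that a divergent series has the value \<open>\<infinity>\<close> instead of an unspecified one.\<close>

definition lq_cost ::
  "real mat \<Rightarrow> real mat \<Rightarrow> real mat \<Rightarrow> real mat \<Rightarrow> real vec \<Rightarrow> real mat \<Rightarrow> ereal" where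
  "lq_cost Q R A B x\<^sub>0 K =
     (\<Sum>t. let x = closed_loop A B K x\<^sub>0 t; u = K *\<^sub>v x
           in ereal (x \<bullet> (Q *\<^sub>v x) + u \<bullet> (R *\<^sub>v u)))"

definition suboptimal_gain ::
  "real mat \<Rightarrow> real mat \<Rightarrow> real vec \<Rightarrow> real \<Rightarrow> real mat \<Rightarrow> real mat \<Rightarrow> real mat \<Rightarrow> bool" where
  "suboptimal_gain Q R x\<^sub>0 \<gamma> A B K \<longleftrightarrow>
     K \<in> carrier_mat (dim_col B) (dim_row A) \<and>
     stable (A + B * K) \<and> lq_cost Q R A B x\<^sub>0 K < ereal \<gamma>"

definition informative_suboptimal_LQR ::
  "real mat \<Rightarrow> real mat \<Rightarrow> real vec \<Rightarrow> real \<Rightarrow> real mat \<Rightarrow> real mat \<Rightarrow> bool" where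
  "informative_suboptimal_LQR Q R x\<^sub>0 \<gamma> U X \<longleftrightarrow>
     (\<exists>K \<in> carrier_mat (dim_row U) (dim_row X).
        \<forall>(A, B) \<in> explaining_systems U X. suboptimal_gain Q R x\<^sub>0 \<gamma> A B K)"

text \<open>The pair of inequalities in the unknowns \<open>P\<close> and \<open>Y\<close>, where \<open>Y\<close> is the
  right inverse of \<open>X\<^sub>-\<close>.\<close>

definition LQR_inequalities ::
  "real mat \<Rightarrow> real mat \<Rightarrow> real vec \<Rightarrow> real \<Rightarrow> real mat \<Rightarrow> real mat \<Rightarrow> real mat \<Rightarrow> real mat \<Rightarrow> bool" where
  "LQR_inequalities Q R x\<^sub>0 \<gamma> U X P Y \<longleftrightarrow>
     negative_definite (dim_row X)
       (transpose_mat (future_states X * Y) * P * (future_states X * Y) - P + Q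
        + transpose_mat (U * Y) * R * (U * Y)) \<and>
     x\<^sub>0 \<bullet> (P *\<^sub>v x\<^sub>0) < \<gamma>"

end

theory Submission
  imports Defs "HOL-Library.Landau_Symbols"
begin

text \<open>A gain \<open>K\<close> that works for every system explaining the data also works for all systems
  obtained by adding multiples of solutions of the homogeneous data equation. Stability for all of
  them forces every left annihilator of \<open>[X\<^sub>-; U\<^sub>-]\<close> to annihilate \<open>[I; K]\<close>, that is, \<open>K = U\<^sub>- Y\<close>
  with a right inverse \<open>Y\<close> of \<open>X\<^sub>-\<close>. The closed loop \<open>A + B K = X\<^sub>+ Y\<close> is then the same matrix
  \<open>M\<close> for all explaining systems, and the claim reduces to a statement about \<open>M\<close> and
  \<open>S = Q + K\<^sup>T R K\<close>. There, an inequality \<open>M\<^sup>T P M - P + S < 0\<close> makes \<open>P\<close> a Lyapunov function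
  that bounds the cost; conversely \<open>P = \<Sum>\<^sub>t (M\<^sup>t)\<^sup>T (S + \<epsilon> I) M\<^sup>t\<close> with small \<open>\<epsilon> > 0\<close> is a solution
  whose value at \<open>x\<^sub>0\<close> exceeds the cost by an arbitrarily small amount.\<close>

section \<open>Orthogonal projection and solvability of linear matrix equations\<close>

lemma scalar_prod_self_pos_iff:
  fixes v :: "real vec"
  assumes "v \<in> carrier_vec n"
  shows "0 < v \<bullet> v \<longleftrightarrow> v \<noteq> 0\<^sub>v n"
proof -
  have "v \<bullet> v = (\<Sum>i<n. (v $ i)\<^sup>2)"
    using assms by (simp add: scalar_prod_def power2_eq_square atLeast0LessThan)
  also have "0 < \<dots> \<longleftrightarrow> (\<exists>i<n. v $ i \<noteq> 0)"
    by (subst less_le) (auto simp: sum_nonneg_eq_0_iff sum_nonneg)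
  also have "\<dots> \<longleftrightarrow> v \<noteq> 0\<^sub>v n"
    using assms by (auto simp: vec_eq_iff)
  finally show ?thesis .
qed

lemma zero_vec_if_scalar_prod_self_le:
  fixes v :: "real vec"
  assumes "v \<in> carrier_vec n" "v \<bullet> v \<le> 0"
  shows "v = 0\<^sub>v n"
  using scalar_prod_self_pos_iff[OF assms(1)] assms(2) by auto

lemma mult_mat_unit_vec:
  fixes A :: "'a :: semiring_1 mat"
  assumes "A \<in> carrier_mat nr nc" "j < nc"
  shows "A *\<^sub>v unit_vec nc j = col A j"
  using assms by (intro eq_vecI) auto

lemma mat_of_cols_Cons_mult_vCons:
  assumes "w \<in> carrier_vec N" "y \<in> carrier_vec (length ws)"
  shows "mat_of_cols N (w # ws) *\<^sub>v vCons c y = c \<cdot>\<^sub>v w + mat_of_cols N ws *\<^sub>v (y :: real vec)"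
proof (rule eq_vecI)
  fix i assume "i < dim_vec (c \<cdot>\<^sub>v w + mat_of_cols N ws *\<^sub>v y)"
  then have i: "i < N" by simp
  have "row (mat_of_cols N (w # ws)) i = vCons (w $ i) (row (mat_of_cols N ws) i)"
    using i by (intro eq_vecI) (auto simp: vec_index_vCons mat_of_cols_index nth_Cons')
  then show "(mat_of_cols N (w # ws) *\<^sub>v vCons c y) $ i = (c \<cdot>\<^sub>v w + mat_of_cols N ws *\<^sub>v y) $ i"
    using i assms by simp
qed (use assms in auto)

text \<open>A Gram-Schmidt step by induction on the columns: the induction hypothesis projects both
  \<open>b\<close> and the new column \<open>w\<close> onto the span of \<open>ws\<close>, and the
  residual of \<open>b\<close> is then corrected along the residual of \<open>w\<close>. Dependent
  columns are covered; there the residual of \<open>w\<close> vanishes.\<close>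

lemma orthogonal_projection_exists:
  fixes b :: "real vec"
  assumes "set ws \<subseteq> carrier_vec N" "b \<in> carrier_vec N"
  shows "\<exists>y \<in> carrier_vec (length ws). \<forall>w \<in> set ws. (b - mat_of_cols N ws *\<^sub>v y) \<bullet> w = 0"
  using assms
proof (induction ws arbitrary: b)
  case Nil
  show ?case by (intro bexI[of _ "0\<^sub>v 0"]) auto
next
  case (Cons w ws)
  let ?W = "mat_of_cols N ws"
  have ws: "v \<in> carrier_vec N" if "v \<in> set ws" for v
    using Cons.prems that by auto
  have W[simp]: "?W \<in> carrier_mat N (length ws)" and w[simp]: "w \<in> carrier_vec N"
    and b[simp]: "b \<in> carrier_vec N"
    using Cons.prems by auto
  obtain y where y[simp]: "y \<in> carrier_vec (length ws)"
    and y0: "\<And>v. v \<in> set ws \<Longrightarrow> (b - ?W *\<^sub>v y) \<bullet> v = 0"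
    using Cons.IH[of b] Cons.prems by auto
  obtain z where z[simp]: "z \<in> carrier_vec (length ws)"
    and z0: "\<And>v. v \<in> set ws \<Longrightarrow> (w - ?W *\<^sub>v z) \<bullet> v = 0"
    using Cons.IH[of w] Cons.prems by auto
  define r where "r = b - ?W *\<^sub>v y"
  define q where "q = w - ?W *\<^sub>v z"
  have r[simp]: "r \<in> carrier_vec N" and q[simp]: "q \<in> carrier_vec N" 
    by (auto simp: r_def q_def intro!: minus_carrier_vec mult_mat_vec_carrier)
  \<comment> \<open>Orthogonality to the columns extends to their span.\<close>
  have orth: "s \<bullet> (?W *\<^sub>v x) = 0"
    if "\<And>v. v \<in> set ws \<Longrightarrow> s \<bullet> v = 0" "s \<in> carrier_vec N" "x \<in> carrier_vec (length ws)" for s x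
  proof -
    have "?W\<^sup>T *\<^sub>v s = 0\<^sub>v (length ws)"
      using that ws by (intro eq_vecI) (auto simp: comm_scalar_prod[OF _ that(2)])
    then show ?thesis
      using transpose_vec_mult_scalar[OF W that(3) that(2)] that(3) by simp
  qed
  \<comment> \<open>The coefficient of the projection of \<open>r\<close> onto \<open>q\<close>. If
    \<open>q\<close> is zero, the division yields 0 and orthogonality to \<open>q\<close> is
    trivial.\<close>
  define c where "c = (r \<bullet> q) / (q \<bullet> q)"
  \<comment> \<open>The coefficients make the new combination equal to
    \<open>?W *\<^sub>v y + c \<cdot>\<^sub>v q\<close>, which changes the residual from
    \<open>r\<close> to \<open>r - c \<cdot>\<^sub>v q\<close>.\<close>
  define y' where "y' = vCons c (y - c \<cdot>\<^sub>v z)"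
  have y': "y' \<in> carrier_vec (length (w # ws))"
    unfolding y'_def by (simp add: minus_carrier_vec)
  have "mat_of_cols N (w # ws) *\<^sub>v y' = c \<cdot>\<^sub>v w + ?W *\<^sub>v (y - c \<cdot>\<^sub>v z)"
    unfolding y'_def by (rule mat_of_cols_Cons_mult_vCons) (auto simp: minus_carrier_vec)
  also have "?W *\<^sub>v (y - c \<cdot>\<^sub>v z) = ?W *\<^sub>v y - c \<cdot>\<^sub>v (?W *\<^sub>v z)"
    by (simp add: mult_minus_distrib_mat_vec[OF W] mult_mat_vec[OF W])
  finally have res: "b - mat_of_cols N (w # ws) *\<^sub>v y' = r - c \<cdot>\<^sub>v q"
    using mult_mat_vec_carrier[OF W y] mult_mat_vec_carrier[OF W z] carrier_vecD[OF w, simp]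
    unfolding r_def q_def by (intro eq_vecI) (auto simp: algebra_simps)
  have res_ws: "(r - c \<cdot>\<^sub>v q) \<bullet> v = 0" if "v \<in> set ws" for v
    using y0[OF that] z0[OF that] ws[OF that]
    by (simp add: minus_scalar_prod_distrib[of _ N] r_def[symmetric] q_def[symmetric])
  have "(r - c \<cdot>\<^sub>v q) \<bullet> q = 0"
  proof (cases "q = 0\<^sub>v N")
    case False
    then have "q \<bullet> q > 0" using scalar_prod_self_pos_iff[OF q] by simp
    then show ?thesis by (simp add: minus_scalar_prod_distrib[of _ N] c_def)
  qed simp
  moreover have "w = q + ?W *\<^sub>v z"
    using mult_mat_vec_carrier[OF W z] by (intro eq_vecI) (auto simp: q_def)
  moreover have "(r - c \<cdot>\<^sub>v q) \<bullet> (?W *\<^sub>v z) = 0"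
    by (rule orth[OF res_ws]) (auto intro: minus_carrier_vec)
  ultimately have "(r - c \<cdot>\<^sub>v q) \<bullet> w = 0"
    using scalar_prod_add_distrib[of "r - c \<cdot>\<^sub>v q" N q "?W *\<^sub>v z"] mult_mat_vec_carrier[OF W z]
    by (metis add.right_neutral minus_carrier_vec q r smult_carrier_vec)
  then show ?case
    using res res_ws y' by (intro bexI[of _ y']) auto
qed

text \<open>The Fredholm alternative, column by column: the residual of projecting a column of
  \<open>G\<close> onto the column space of \<open>W\<close> is a left annihilator of
  \<open>W\<close>, so it is orthogonal to that column of \<open>G\<close> and hence to
  itself.\<close>

lemma mat_mult_solvable_if_left_kernel_subset:
  fixes W G :: "real mat"
  assumes W: "W \<in> carrier_mat N T" and G: "G \<in> carrier_mat N n"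
    and ker: "\<And>r z. r \<in> carrier_vec N \<Longrightarrow> (\<And>y. y \<in> carrier_vec T \<Longrightarrow> r \<bullet> (W *\<^sub>v y) = 0) \<Longrightarrow>
               z \<in> carrier_vec n \<Longrightarrow> r \<bullet> (G *\<^sub>v z) = 0"
  shows "\<exists>Y \<in> carrier_mat T n. W * Y = G"
proof -
  have "\<exists>y \<in> carrier_vec T. W *\<^sub>v y = col G j" if j: "j < n" for j
  proof -
    have Wc: "mat_of_cols N (cols W) = W" and len: "length (cols W) = T"
      using W by auto
    have b: "col G j \<in> carrier_vec N" using G j by auto
    obtain y where y: "y \<in> carrier_vec T" and orth: "\<And>w. w \<in> set (cols W) \<Longrightarrow> (col G j - W *\<^sub>v y) \<bullet> w = 0"
      using orthogonal_projection_exists[of "cols W" N "col G j"] W b unfolding Wc len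
      using cols_dim by blast
    define r where "r = col G j - W *\<^sub>v y"
    have Wy: "W *\<^sub>v y \<in> carrier_vec N" using W y by auto
    then have r: "r \<in> carrier_vec N" using b by (simp add: r_def minus_carrier_vec)
    have "W\<^sup>T *\<^sub>v r = 0\<^sub>v T"
      using orth W r unfolding r_def[symmetric]
      by (intro eq_vecI) (auto simp: cols_def comm_scalar_prod[OF _ r])
    then have rW: "r \<bullet> (W *\<^sub>v x) = 0" if "x \<in> carrier_vec T" for x
      using transpose_vec_mult_scalar[OF W that r] that by simp
    have "G *\<^sub>v unit_vec n j = col G j" by (rule mult_mat_unit_vec[OF G j])
    then have "r \<bullet> col G j = 0"
      using ker[OF r rW, of "unit_vec n j"] by simp
    then have "r \<bullet> r = 0"
      using rW[OF y] scalar_prod_minus_distrib[OF r b Wy] by (simp add: r_def)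
    then have "r = 0\<^sub>v N" by (intro zero_vec_if_scalar_prod_self_le[OF r]) simp
    then have "col G j $ i - (W *\<^sub>v y) $ i = 0" if "i < N" for i
      using that index_minus_vec(1)[of i "W *\<^sub>v y" "col G j"] Wy
      by (metis carrier_vecD index_zero_vec(1) r_def)
    then have "col G j $ i = (W *\<^sub>v y) $ i" if "i < N" for i
      using that by auto
    then have "W *\<^sub>v y = col G j" using b Wy W G by (intro eq_vecI) (auto simp del: index_mult_mat_vec)
    then show ?thesis using y by blast
  qed
  then obtain f where f: "\<And>j. j < n \<Longrightarrow> f j \<in> carrier_vec T \<and> W *\<^sub>v f j = col G j"
    by metis
  define Y where "Y = mat_of_cols T (map f [0..<n])"
  have Y: "Y \<in> carrier_mat T n" by (simp add: Y_def carrier_matI)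
  have "col Y j = f j" if "j < n" for j
    using f[OF that] that by (simp add: Y_def)
  then have "col (W * Y) j = col G j" if "j < n" for j
    using f[OF that] that unfolding col_mult2[OF W Y that] by simp
  then have "W * Y = G"
    using W G Y by (intro mat_col_eqI) (auto simp del: col_mult2 col_mult)
  then show ?thesis using Y by blast
qed

section \<open>Matrix powers and their geometric decay under stability\<close>

lemma smult_mat_mult_vec:
  fixes A :: "'a :: comm_ring_1 mat"
  assumes "A \<in> carrier_mat nr nc" "v \<in> carrier_vec nc"
  shows "(c \<cdot>\<^sub>m A) *\<^sub>v v = c \<cdot>\<^sub>v (A *\<^sub>v v)"
  using assms by (intro eq_vecI) (auto simp: row_smult)

lemma smult_mat_pow:
  fixes A :: "'a :: comm_ring_1 mat"
  assumes "A \<in> carrier_mat n n"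
  shows "(c \<cdot>\<^sub>m A) ^\<^sub>m k = c ^ k \<cdot>\<^sub>m (A ^\<^sub>m k)"
proof (induction k)
  case 0
  show ?case using assms by (intro eq_matI) auto
next
  case (Suc k)
  have [simp]: "A ^\<^sub>m k \<in> carrier_mat n n" using assms by simp
  have "c ^ k \<cdot>\<^sub>m (A ^\<^sub>m k) * (c \<cdot>\<^sub>m A) = c ^ Suc k \<cdot>\<^sub>m (A ^\<^sub>m k * A)"
    using assms by (intro eq_matI) (auto simp: algebra_simps)
  then show ?case using Suc by simp
qed

lemma pow_mat_Suc_mult_vec:
  assumes "A \<in> carrier_mat n n" "v \<in> carrier_vec n"
  shows "A ^\<^sub>m Suc k *\<^sub>v v = A ^\<^sub>m k *\<^sub>v (A *\<^sub>v v)"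
  using assms by (simp add: assoc_mult_mat_vec[of _ n n _ n])

text \<open>The recursion of \<open>^\<^sub>m\<close> appends factors on the right, which changes
  the initial vector; here the extra factor acts last, as in the recursion of
  \<open>closed_loop\<close>.\<close>

lemma pow_mat_Suc_mult_vec':
  assumes "A \<in> carrier_mat n n" "v \<in> carrier_vec n"
  shows "A ^\<^sub>m Suc k *\<^sub>v v = A *\<^sub>v (A ^\<^sub>m k *\<^sub>v v)"
  using assms(2)
proof (induction k arbitrary: v)
  case 0
  then show ?case using assms(1) by simp
next
  case (Suc k)
  have [simp]: "A *\<^sub>v v \<in> carrier_vec n" using assms(1) Suc.prems by simp
  have "A ^\<^sub>m Suc (Suc k) *\<^sub>v v = A ^\<^sub>m Suc k *\<^sub>v (A *\<^sub>v v)"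
    by (rule pow_mat_Suc_mult_vec[OF assms(1) Suc.prems])
  also have "\<dots> = A *\<^sub>v (A ^\<^sub>m k *\<^sub>v (A *\<^sub>v v))" by (rule Suc.IH) simp
  also have "A ^\<^sub>m k *\<^sub>v (A *\<^sub>v v) = A ^\<^sub>m Suc k *\<^sub>v v"
    by (rule pow_mat_Suc_mult_vec[OF assms(1) Suc.prems, symmetric])
  finally show ?case .
qed

text \<open>Scaling the matrix by the reciprocal of a number between its spectral radius and 1 keeps
  it stable, so that bounded powers become geometrically decaying ones.\<close>

lemma stable_imp_pow_entries_bigo:
  assumes M: "M \<in> carrier_mat n n" and stable: "stable M"
  obtains \<rho> :: real where "0 < \<rho>" "\<rho> < 1"
    "\<And>i j. i < n \<Longrightarrow> j < n \<Longrightarrow> (\<lambda>k. (M ^\<^sub>m k) $$ (i, j)) \<in> O(\<lambda>k. \<rho> ^ k)"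
proof (cases "n = 0")
  case True
  \<comment> \<open>In dimension 0 the spectrum is empty and its maximum modulus says nothing; there
    are no entries to bound, so any rate between 0 and 1 serves.\<close>
  then show ?thesis using that[of "1 / 2"] by auto
next
  case False
  let ?C = "map_mat complex_of_real M"
  have C: "?C \<in> carrier_mat n n" using M by simp
  have "spectral_radius ?C \<in> norm ` spectrum ?C"
    using spectral_radius_mem_max(1)[OF C] False by simp
  then have r: "0 \<le> spectral_radius ?C" "spectral_radius ?C < 1"
    using stable by (auto simp: stable_def spectrum_def)
  obtain \<rho> where \<rho>: "spectral_radius ?C < \<rho>" "\<rho> < 1" using dense[OF r(2)] by blast
  with r have \<rho>0: "0 < \<rho>" by simp
  let ?D = "complex_of_real (1 / \<rho>) \<cdot>\<^sub>m ?C"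
  have D: "?D \<in> carrier_mat n n" using C by simp
  \<comment> \<open>An eigenvalue \<open>z\<close> of \<open>?D\<close> makes
    \<open>\<rho> * z\<close> an eigenvalue of \<open>?C\<close>, whose modulus is at most the
    spectral radius and thus below \<open>\<rho>\<close>.\<close>
  have "cmod z < 1" if "z \<in> spectrum ?D" for z
  proof -
    from that obtain v where v: "v \<in> carrier_vec n" "v \<noteq> 0\<^sub>v n" "?D *\<^sub>v v = z \<cdot>\<^sub>v v"
      using D by (auto simp: spectrum_def eigenvalue_def eigenvector_def)
    have "?C *\<^sub>v v = of_real \<rho> \<cdot>\<^sub>v (?D *\<^sub>v v)"
      using \<rho>0 C v(1) by (simp add: smult_mat_mult_vec[OF C v(1)] smult_smult_assoc)
    also have "\<dots> = (of_real \<rho> * z) \<cdot>\<^sub>v v"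
      by (simp only: v(3) smult_smult_assoc)
    finally have "of_real \<rho> * z \<in> spectrum ?C"
      using v C by (auto simp: spectrum_def eigenvalue_def eigenvector_def)
    then have "norm (of_real \<rho> * z) \<le> spectral_radius ?C"
      using spectral_radius_mem_max(2)[OF C] False by blast
    then have "\<rho> * cmod z \<le> spectral_radius ?C" using \<rho>0 by (simp add: norm_mult)
    with \<rho>(1) have "\<rho> * cmod z < \<rho> * 1" by linarith
    then show ?thesis using \<rho>0 by (simp only: mult_less_cancel_left_pos)
  qed
  then have "spectral_radius ?D < 1"
    using spectral_radius_mem_max(1)[OF D] False by auto
  then obtain c where c: "\<And>k. norm_bound (?D ^\<^sub>m k) c"
    using spectral_radius_jnf_norm_bound_less_1_upper_triangular[OF D] by blast
  show ?thesis
  proof (rule that[OF \<rho>0 \<rho>(2)])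
    fix i j assume ij: "i < n" "j < n"
    have "\<bar>(M ^\<^sub>m k) $$ (i, j)\<bar> \<le> c * \<bar>\<rho> ^ k\<bar>" for k
    proof -
      have "(?D ^\<^sub>m k) $$ (i, j) = of_real ((1 / \<rho>) ^ k * (M ^\<^sub>m k) $$ (i, j))"
        using ij M C pow_carrier_mat[OF M, of k]
        by (simp add: smult_mat_pow[OF C] of_real_hom.mat_hom_pow[OF M, symmetric])
      moreover have "norm ((?D ^\<^sub>m k) $$ (i, j)) \<le> c"
        using c[of k, unfolded norm_bound_def, rule_format, of i j] ij
        unfolding pow_mat_dim_square[OF D] .
      ultimately have "\<bar>(1 / \<rho>) ^ k * (M ^\<^sub>m k) $$ (i, j)\<bar> \<le> c"
        by (simp only: norm_of_real)
      then show ?thesis using \<rho>0 by (simp add: abs_mult power_divide field_simps)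
    qed
    then show "(\<lambda>k. (M ^\<^sub>m k) $$ (i, j)) \<in> O(\<lambda>k. \<rho> ^ k)"
      by (intro bigoI[where c = c]) auto
  qed
qed

section \<open>Quadratic forms and the Lyapunov series\<close>

lemma quadratic_form_eq_sum:
  assumes "F \<in> carrier_mat n n" "v \<in> carrier_vec n" "w \<in> carrier_vec n"
  shows "v \<bullet> (F *\<^sub>v w) = (\<Sum>i<n. \<Sum>j<n. v $ i * F $$ (i, j) * (w $ j :: real))"
  using assms
  by (simp add: scalar_prod_def atLeast0LessThan sum_distrib_left mult.assoc)

text \<open>Two separate vectors are allowed so that unit vectors can read off single entries of the
  congruence.\<close>

lemma congruence_form:
  fixes S :: "real mat"
  assumes "N \<in> carrier_mat m n" "S \<in> carrier_mat m m" "v \<in> carrier_vec n" "w \<in> carrier_vec n"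
  shows "v \<bullet> ((N\<^sup>T * S * N) *\<^sub>v w) = (N *\<^sub>v v) \<bullet> (S *\<^sub>v (N *\<^sub>v w))"
proof -
  have Nw: "S *\<^sub>v (N *\<^sub>v w) \<in> carrier_vec m" and Nv: "N *\<^sub>v v \<in> carrier_vec m" using assms by auto
  have NT: "N\<^sup>T \<in> carrier_mat n m" using assms by simp
  have "(N\<^sup>T * S * N) *\<^sub>v w = N\<^sup>T *\<^sub>v (S *\<^sub>v (N *\<^sub>v w))"
    using assms NT
    by (simp add: assoc_mult_mat_vec[of "N\<^sup>T * S" n m N n] assoc_mult_mat_vec[of "N\<^sup>T" n m S m]
        del: assoc_mult_mat)
  then show ?thesis
    using transpose_vec_mult_scalar[of N m n v "S *\<^sub>v (N *\<^sub>v w)"] Nw Nv assms NT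
    by (metis comm_scalar_prod mult_mat_vec_carrier)
qed

lemma symmetric_matrix_congruence:
  assumes "N \<in> carrier_mat m n" "symmetric_matrix m S"
  shows "symmetric_matrix n (N\<^sup>T * S * N)"
proof -
  have S: "S \<in> carrier_mat m m" "S\<^sup>T = S" using assms(2) by (auto simp: symmetric_matrix_def)
  have NT: "N\<^sup>T \<in> carrier_mat n m" using assms by simp
  have "(N\<^sup>T * S * N)\<^sup>T = N\<^sup>T * (N\<^sup>T * S)\<^sup>T"
    using assms(1) S NT by (intro transpose_mult[of _ n m _ n]) auto
  also have "(N\<^sup>T * S)\<^sup>T = S * N"
    using transpose_mult[OF NT S(1)] S by simp
  finally show ?thesis
    using assms(1) S NT by (simp add: symmetric_matrix_def assoc_mult_mat[of _ n m _ m _ n])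
qed

text \<open>\<open>P\<close> is the series of the matrices \<open>F k\<close>, formed entry by
  entry. The entries converge absolutely by comparison with a geometric series, and a quadratic form
  is a finite sum over entries, so its values converge as well.\<close>

lemma lyapunov_series:
  assumes M: "M \<in> carrier_mat n n" and stable: "stable M" and S: "symmetric_matrix n S"
  obtains P where "symmetric_matrix n P"
    "\<And>v. v \<in> carrier_vec n \<Longrightarrow>
       (\<lambda>k. (M ^\<^sub>m k *\<^sub>v v) \<bullet> (S *\<^sub>v (M ^\<^sub>m k *\<^sub>v v))) sums (v \<bullet> (P *\<^sub>v v))"
proof -
  define F where "F k = (M ^\<^sub>m k)\<^sup>T * S * (M ^\<^sub>m k)" for k
  have Sc: "S \<in> carrier_mat n n" using S by (simp add: symmetric_matrix_def)
  have Mk: "M ^\<^sub>m k \<in> carrier_mat n n" for k using M by simp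
  have F_sym: "symmetric_matrix n (F k)" for k
    unfolding F_def by (rule symmetric_matrix_congruence[OF Mk S])
  then have F: "F k \<in> carrier_mat n n" and F_T: "(F k)\<^sup>T = F k" for k
    by (auto simp: symmetric_matrix_def)
  obtain \<rho> where \<rho>: "0 < \<rho>" "\<rho> < 1"
    "\<And>i j. i < n \<Longrightarrow> j < n \<Longrightarrow> (\<lambda>k. (M ^\<^sub>m k) $$ (i, j)) \<in> O(\<lambda>k. \<rho> ^ k)"
    using stable_imp_pow_entries_bigo[OF M stable] by blast
  \<comment> \<open>Each entry of \<open>F k\<close> combines products of two entries of
    \<open>M ^\<^sub>m k\<close>, so the comparison series has ratio
    \<open>\<rho> * \<rho>\<close>.\<close>
  have "norm (\<rho> * \<rho>) < 1" using \<rho> mult_strict_mono[of \<rho> 1 \<rho> 1] by simp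
  then have geometric: "summable (\<lambda>k. norm (\<rho> ^ k * \<rho> ^ k))"
    using \<rho>(1) summable_geometric by (simp add: power_mult_distrib[symmetric])
  have F_entry: "F k $$ (i, j) = (\<Sum>a<n. \<Sum>b<n. S $$ (a, b) * ((M ^\<^sub>m k) $$ (a, i) * (M ^\<^sub>m k) $$ (b, j)))"
    if "i < n" "j < n" for i j k
  proof -
    have "F k $$ (i, j) = unit_vec n i \<bullet> (F k *\<^sub>v unit_vec n j)"
      using that F[of k] by simp
    also have "\<dots> = col (M ^\<^sub>m k) i \<bullet> (S *\<^sub>v col (M ^\<^sub>m k) j)"
    proof -
      have "M ^\<^sub>m k *\<^sub>v unit_vec n l = col (M ^\<^sub>m k) l" if "l < n" for l
        by (rule mult_mat_unit_vec[OF Mk that])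
      then show ?thesis unfolding F_def using that by (simp add: congruence_form[OF Mk Sc])
    qed
    also have "\<dots> = (\<Sum>a<n. \<Sum>b<n. S $$ (a, b) * ((M ^\<^sub>m k) $$ (a, i) * (M ^\<^sub>m k) $$ (b, j)))"
      using that M Mk[of k] by (subst quadratic_form_eq_sum[OF Sc]) (auto intro!: sum.cong simp: ac_simps)
    finally show ?thesis .
  qed
  have summable: "summable (\<lambda>k. F k $$ (i, j))" if ij: "i < n" "j < n" for i j
  proof (rule summable_comparison_test_bigo)
    show "summable (\<lambda>k. norm (\<rho> ^ k * \<rho> ^ k))" by (fact geometric)
    show "(\<lambda>k. F k $$ (i, j)) \<in> O(\<lambda>k. \<rho> ^ k * \<rho> ^ k)"
      unfolding F_entry[OF ij]
      using ij
      by (intro big_sum_in_bigo cmult_in_bigo_iff[THEN iffD2] disjI2 landau_o.big.mult \<rho>(3)) auto 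
  qed
  define P where "P = mat n n (\<lambda>(i, j). \<Sum>k. F k $$ (i, j))"
  have P: "P \<in> carrier_mat n n" by (simp add: P_def)
  have "F k $$ (i, j) = F k $$ (j, i)" if "i < n" "j < n" for i j k
    using arg_cong[OF F_T[of k], of "\<lambda>A. A $$ (i, j)"] F[of k] that by simp
  then have "symmetric_matrix n P"
    unfolding symmetric_matrix_def by (intro conjI P eq_matI) (auto simp: P_def)
  moreover have "(\<lambda>k. (M ^\<^sub>m k *\<^sub>v v) \<bullet> (S *\<^sub>v (M ^\<^sub>m k *\<^sub>v v))) sums (v \<bullet> (P *\<^sub>v v))"
    if v: "v \<in> carrier_vec n" for v
  proof -
    have "(\<lambda>k. F k $$ (i, j)) sums (P $$ (i, j))" if "i < n" "j < n" for i j
      using summable_sums[OF summable[OF that]] that by (simp add: P_def)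
    then have "(\<lambda>k. v \<bullet> (F k *\<^sub>v v)) sums (v \<bullet> (P *\<^sub>v v))"
      unfolding quadratic_form_eq_sum[OF F v v] quadratic_form_eq_sum[OF P v v]
      by (intro sums_sum sums_mult sums_mult2) auto
    then show ?thesis
      unfolding F_def by (simp add: congruence_form[OF Mk Sc v v])
  qed
  ultimately show ?thesis using that by blast
qed

section \<open>Decreasing quadratic forms, eigenvectors and stability\<close>

text \<open>For a complex eigenvector \<open>a + \<i> b\<close> with eigenvalue \<open>z\<close>, the cross terms cancel in
  \<open>q (M a) + q (M b) = \<bar>z\<bar>\<^sup>2 (q a + q b)\<close>, where \<open>q\<close> is the quadratic form of \<open>P\<close>.\<close>

lemma stable_if_form_decreasing:
  fixes P :: "real mat"
  assumes M: "M \<in> carrier_mat n n" and P: "P \<in> carrier_mat n n"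
    and nonneg: "\<And>v. v \<in> carrier_vec n \<Longrightarrow> 0 \<le> v \<bullet> (P *\<^sub>v v)"
    and decr: "\<And>v. v \<in> carrier_vec n \<Longrightarrow> v \<noteq> 0\<^sub>v n \<Longrightarrow> (M *\<^sub>v v) \<bullet> (P *\<^sub>v (M *\<^sub>v v)) < v \<bullet> (P *\<^sub>v v)"
  shows "stable M"
  unfolding stable_def
proof (intro allI impI)
  fix z assume "eigenvalue (map_mat complex_of_real M) z"
  then obtain v where v: "v \<in> carrier_vec n" "v \<noteq> 0\<^sub>v n" "map_mat complex_of_real M *\<^sub>v v = z \<cdot>\<^sub>v v"
    using M by (auto simp: eigenvalue_def eigenvector_def)
  define a where "a = map_vec Re v"
  define b where "b = map_vec Im v"
  have ab[simp]: "a \<in> carrier_vec n" "b \<in> carrier_vec n" using v by (auto simp: a_def b_def)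
  define q where "q v = v \<bullet> (P *\<^sub>v v)" for v
  have entry: "(\<Sum>j<n. complex_of_real (M $$ (i, j)) * v $ j) = z * v $ i" if "i < n" for i
    using arg_cong[OF v(3), of "\<lambda>w. w $ i"] v(1) M that
    by (simp add: scalar_prod_def atLeast0LessThan)
  \<comment> \<open>Real and imaginary part of the eigenvector equation: \<open>M\<close> acts on
    the pair \<open>a\<close>, \<open>b\<close> as multiplication by \<open>z\<close> acts on real
    and imaginary parts.\<close>
  have Ma: "M *\<^sub>v a = Re z \<cdot>\<^sub>v a + (- Im z) \<cdot>\<^sub>v b"
    using arg_cong[OF entry, of _ Re] v(1) M
    by (intro eq_vecI) (auto simp: a_def b_def scalar_prod_def atLeast0LessThan Re_sum)
  have Mb: "M *\<^sub>v b = Im z \<cdot>\<^sub>v a + Re z \<cdot>\<^sub>v b"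
    using arg_cong[OF entry, of _ Im] v(1) M
    by (intro eq_vecI) (auto simp: a_def b_def scalar_prod_def atLeast0LessThan Im_sum)
  have q_comb: "q (c \<cdot>\<^sub>v a + d \<cdot>\<^sub>v b) =
      c\<^sup>2 * q a + c * d * (a \<bullet> (P *\<^sub>v b) + b \<bullet> (P *\<^sub>v a)) + d\<^sup>2 * q b" for c d
  proof -
    have [simp]: "P *\<^sub>v a \<in> carrier_vec n" "P *\<^sub>v b \<in> carrier_vec n" using P by auto
    have "P *\<^sub>v (c \<cdot>\<^sub>v a + d \<cdot>\<^sub>v b) = c \<cdot>\<^sub>v (P *\<^sub>v a) + d \<cdot>\<^sub>v (P *\<^sub>v b)"
      using P by (simp add: mult_add_distrib_mat_vec[OF P] mult_mat_vec[OF P])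
    then show ?thesis
      by (simp add: q_def add_scalar_prod_distrib[of _ n] scalar_prod_add_distrib[of _ n]
          smult_scalar_prod_distrib[of _ n] scalar_prod_smult_distrib[of _ n] power2_eq_square algebra_simps)
  qed
  have "q (M *\<^sub>v a) + q (M *\<^sub>v b) = (cmod z)\<^sup>2 * (q a + q b)"
    unfolding Ma Mb q_comb cmod_power2 by (simp add: algebra_simps)
  moreover have le: "q (M *\<^sub>v w) \<le> q w" if "w \<in> carrier_vec n" for w
  proof (cases "w = 0\<^sub>v n")
    case True
    have "M *\<^sub>v 0\<^sub>v n = 0\<^sub>v n" using M by (intro eq_vecI) auto
    then show ?thesis using True by (simp add: q_def)
  qed (use decr[OF that] in \<open>simp add: q_def\<close>)
  \<comment> \<open>At least one of the two parts is nonzero and decreases strictly; the other may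
    vanish and contributes through \<open>le\<close>.\<close>
  have "a \<noteq> 0\<^sub>v n \<or> b \<noteq> 0\<^sub>v n"
    using v(1,2) by (auto simp: vec_eq_iff a_def b_def complex_eq_iff)
  then have "q (M *\<^sub>v a) + q (M *\<^sub>v b) < q a + q b"
    using decr[of a] decr[of b] le[of a] le[of b] by (fastforce simp: q_def)
  ultimately have "(cmod z)\<^sup>2 * (q a + q b) < 1 * (q a + q b)" by simp
  moreover have "0 \<le> q a + q b" using nonneg by (simp add: q_def)
  ultimately have "(cmod z)\<^sup>2 < 1" by (metis mult_right_mono not_le)
  then show "cmod z < 1" by (simp add: power_less_one_iff abs_square_less_1)
qed

text \<open>A real eigenvector embeds as a complex one. This serves to refute stability by
  exhibiting a real eigenvector with a large eigenvalue.\<close>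

lemma stable_eigenvector_bound:
  assumes M: "M \<in> carrier_mat n n" and stable: "stable M"
    and v: "v \<in> carrier_vec n" "v \<noteq> 0\<^sub>v n" "M *\<^sub>v v = c \<cdot>\<^sub>v v"
  shows "\<bar>c\<bar> < 1"
proof -
  have "map_mat complex_of_real M *\<^sub>v map_vec complex_of_real v = of_real c \<cdot>\<^sub>v map_vec of_real v"
    using of_real_hom.mult_mat_vec_hom[OF M v(1)] v(3) of_real_hom.vec_hom_smult by metis
  moreover have "map_vec complex_of_real v \<noteq> 0\<^sub>v n"
    using v by (auto simp: vec_eq_iff)
  ultimately have "eigenvalue (map_mat complex_of_real M) (of_real c)"
    using M v(1) unfolding eigenvalue_def eigenvector_def by (intro exI[of _ "map_vec of_real v"]) auto
  then have "cmod (of_real c) < 1" using stable by (simp only: stable_def)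
  then show ?thesis by simp
qed

section \<open>Lyapunov certificates for stability and bounded cost\<close>

text \<open>Reads the matrix expression as the change of the form of \<open>P\<close> along one step
  of \<open>M\<close> plus the stage cost, so that negative definiteness becomes a dissipation
  inequality.\<close>

lemma certificate_form:
  fixes M P S :: "real mat"
  assumes "M \<in> carrier_mat n n" "P \<in> carrier_mat n n" "S \<in> carrier_mat n n" "v \<in> carrier_vec n"
  shows "v \<bullet> ((M\<^sup>T * P * M - P + S) *\<^sub>v v) =
    (M *\<^sub>v v) \<bullet> (P *\<^sub>v (M *\<^sub>v v)) - v \<bullet> (P *\<^sub>v v) + v \<bullet> (S *\<^sub>v v)"
proof -
  have L: "M\<^sup>T * P * M \<in> carrier_mat n n" using assms by auto
  have "(M\<^sup>T * P * M - P + S) *\<^sub>v v = (M\<^sup>T * P * M) *\<^sub>v v - P *\<^sub>v v + S *\<^sub>v v"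
    using assms L by (simp add: add_mult_distrib_mat_vec[of _ n n] minus_mult_distrib_mat_vec[of _ n n]
        minus_carrier_mat del: assoc_mult_mat)
  moreover have "(M\<^sup>T * P * M) *\<^sub>v v \<in> carrier_vec n" "P *\<^sub>v v \<in> carrier_vec n" "S *\<^sub>v v \<in> carrier_vec n"
    using assms L mult_mat_vec_carrier by blast+
  ultimately show ?thesis
    using assms(4) congruence_form[OF assms(1,2,4,4)]
    by (simp add: scalar_prod_add_distrib[of _ n] scalar_prod_minus_distrib[of _ n] minus_carrier_vec
        del: assoc_mult_mat)
qed

text \<open>A certificate bounds the cost by telescoping its decrease along the trajectory.
  Conversely, \<open>P0\<close> and \<open>P1\<close> come from the series for \<open>S\<close> and
  for the identity: the form of \<open>P0\<close> has the cost as its value at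
  \<open>x\<^sub>0\<close>, and a small multiple of \<open>P1\<close> makes positivity and decrease
  strict.\<close>

lemma stable_and_cost_less_iff_certificate:
  fixes S :: "real mat"
  assumes M: "M \<in> carrier_mat n n" and S: "positive_semidefinite n S" and x\<^sub>0: "x\<^sub>0 \<in> carrier_vec n"
  shows "stable M \<and> (\<Sum>t. ereal ((M ^\<^sub>m t *\<^sub>v x\<^sub>0) \<bullet> (S *\<^sub>v (M ^\<^sub>m t *\<^sub>v x\<^sub>0)))) < ereal \<gamma> \<longleftrightarrow>
    (\<exists>P. positive_definite n P \<and> negative_definite n (M\<^sup>T * P * M - P + S) \<and> x\<^sub>0 \<bullet> (P *\<^sub>v x\<^sub>0) < \<gamma>)"
    (is "_ \<and> suminf (\<lambda>t. ereal (?s t)) < _ \<longleftrightarrow> _")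
proof -
  have S_sym: "symmetric_matrix n S" and Sc: "S \<in> carrier_mat n n"
    and S_nonneg: "\<And>v. v \<in> carrier_vec n \<Longrightarrow> 0 \<le> v \<bullet> (S *\<^sub>v v)"
    using S by (auto simp: positive_semidefinite_def symmetric_matrix_def)
  have traj: "M ^\<^sub>m t *\<^sub>v v \<in> carrier_vec n" if "v \<in> carrier_vec n" for t v
    using that M by (meson mult_mat_vec_carrier pow_carrier_mat)
  show ?thesis
  proof (intro iffI; (elim exE conjE)?)
    fix P assume pos: "positive_definite n P" and neg: "negative_definite n (M\<^sup>T * P * M - P + S)"
      and less: "x\<^sub>0 \<bullet> (P *\<^sub>v x\<^sub>0) < \<gamma>"
    have P: "P \<in> carrier_mat n n" and P_pos: "\<And>v. v \<in> carrier_vec n \<Longrightarrow> v \<noteq> 0\<^sub>v n \<Longrightarrow> 0 < v \<bullet> (P *\<^sub>v v)"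
      using pos by (auto simp: positive_definite_def symmetric_matrix_def)
    have P_nonneg: "0 \<le> v \<bullet> (P *\<^sub>v v)" if "v \<in> carrier_vec n" for v
      using P_pos[OF that] P by (cases "v = 0\<^sub>v n") auto
    have decr: "(M *\<^sub>v v) \<bullet> (P *\<^sub>v (M *\<^sub>v v)) + v \<bullet> (S *\<^sub>v v) < v \<bullet> (P *\<^sub>v v)"
      if "v \<in> carrier_vec n" "v \<noteq> 0\<^sub>v n" for v
      using neg certificate_form[OF M P Sc that(1)] that by (auto simp: negative_definite_def)
    have "(M *\<^sub>v v) \<bullet> (P *\<^sub>v (M *\<^sub>v v)) < v \<bullet> (P *\<^sub>v v)"
      if "v \<in> carrier_vec n" "v \<noteq> 0\<^sub>v n" for v
      using decr[OF that] S_nonneg[OF that(1)] by linarith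
    then have "stable M" using stable_if_form_decreasing[OF M P P_nonneg] by blast
    have "M *\<^sub>v 0\<^sub>v n = 0\<^sub>v n" using M by (intro eq_vecI) auto
    then have le: "(M *\<^sub>v v) \<bullet> (P *\<^sub>v (M *\<^sub>v v)) + v \<bullet> (S *\<^sub>v v) \<le> v \<bullet> (P *\<^sub>v v)"
      if "v \<in> carrier_vec n" for v
      using decr[OF that] P Sc by (cases "v = 0\<^sub>v n") auto
    \<comment> \<open>Telescoping: the form at the current state pays for the next stage cost. The
      final value is kept for the induction and afterwards dropped as nonnegative.\<close>
    have "(\<Sum>t<N. ?s t) + (M ^\<^sub>m N *\<^sub>v x\<^sub>0) \<bullet> (P *\<^sub>v (M ^\<^sub>m N *\<^sub>v x\<^sub>0)) \<le> x\<^sub>0 \<bullet> (P *\<^sub>v x\<^sub>0)" for N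
    proof (induction N)
      case 0
      then show ?case using M x\<^sub>0 by simp
    next
      case (Suc N)
      then show ?case
        using le[OF traj[OF x\<^sub>0, of N]] unfolding pow_mat_Suc_mult_vec'[OF M x\<^sub>0] by simp
    qed
    then have "(\<Sum>t<N. ?s t) \<le> x\<^sub>0 \<bullet> (P *\<^sub>v x\<^sub>0)" for N
      using P_nonneg[OF traj[OF x\<^sub>0, of N]] by (meson add_increasing2 le_add_same_cancel1 order_trans)
    then have "(\<Sum>t. ereal (?s t)) \<le> ereal (x\<^sub>0 \<bullet> (P *\<^sub>v x\<^sub>0))"
      using S_nonneg[OF traj[OF x\<^sub>0]] by (intro suminf_bound) auto
    also have "\<dots> < ereal \<gamma>" using less by simp
    finally show "stable M \<and> (\<Sum>t. ereal (?s t)) < ereal \<gamma>" using \<open>stable M\<close> by blast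
  next
    assume "stable M" and cost: "(\<Sum>t. ereal (?s t)) < ereal \<gamma>"
    obtain P0 where P0: "symmetric_matrix n P0"
      and P0_sums: "\<And>v. v \<in> carrier_vec n \<Longrightarrow>
        (\<lambda>k. (M ^\<^sub>m k *\<^sub>v v) \<bullet> (S *\<^sub>v (M ^\<^sub>m k *\<^sub>v v))) sums (v \<bullet> (P0 *\<^sub>v v))"
      using lyapunov_series[OF M \<open>stable M\<close> S_sym] by blast
    have one: "symmetric_matrix n (1\<^sub>m n)" by (simp add: symmetric_matrix_def)
    obtain P1 where P1: "symmetric_matrix n P1"
      and P1_sums: "\<And>v. v \<in> carrier_vec n \<Longrightarrow>
        (\<lambda>k. (M ^\<^sub>m k *\<^sub>v v) \<bullet> (1\<^sub>m n *\<^sub>v (M ^\<^sub>m k *\<^sub>v v))) sums (v \<bullet> (P1 *\<^sub>v v))"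
      using lyapunov_series[OF M \<open>stable M\<close> one] by blast
    \<comment> \<open>Splitting off the first term of the series and shifting the index gives the
      Stein equation \<open>P = W + M\<^sup>T * P * M\<close> on the level of forms.\<close>
    have stein: "v \<bullet> (P *\<^sub>v v) = v \<bullet> (W *\<^sub>v v) + (M *\<^sub>v v) \<bullet> (P *\<^sub>v (M *\<^sub>v v))"
      if sums: "\<And>v. v \<in> carrier_vec n \<Longrightarrow>
          (\<lambda>k. (M ^\<^sub>m k *\<^sub>v v) \<bullet> (W *\<^sub>v (M ^\<^sub>m k *\<^sub>v v))) sums (v \<bullet> (P *\<^sub>v v))"
        and v: "v \<in> carrier_vec n" for P W v
    proof -
      have "M *\<^sub>v v \<in> carrier_vec n" using M v by simp
      from sums[OF this] show ?thesis
        using sums[OF v] M v unfolding pow_mat_Suc_mult_vec[OF M v, symmetric]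
        by (subst (asm) sums_Suc_iff) (auto dest: sums_unique2)
    qed
    \<comment> \<open>The gap between \<open>\<gamma>\<close> and the cost is the room for the
      perturbation. The denominator is positive and exceeds the form of \<open>P1\<close> at
      \<open>x\<^sub>0\<close>, which keeps the perturbed value below
      \<open>\<gamma>\<close>.\<close>
    define \<epsilon> where "\<epsilon> = (\<gamma> - x\<^sub>0 \<bullet> (P0 *\<^sub>v x\<^sub>0)) / (1 + \<bar>x\<^sub>0 \<bullet> (P1 *\<^sub>v x\<^sub>0)\<bar>)"
    define P where "P = P0 + \<epsilon> \<cdot>\<^sub>m P1"
    have Pc: "P0 \<in> carrier_mat n n" "P1 \<in> carrier_mat n n" "P \<in> carrier_mat n n"
      using P0 P1 by (auto simp: symmetric_matrix_def P_def)
    have "(\<epsilon> \<cdot>\<^sub>m P1)\<^sup>T = \<epsilon> \<cdot>\<^sub>m P1\<^sup>T" by (intro eq_matI) auto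
    then have P_sym: "symmetric_matrix n P"
      using P0 P1 by (auto simp: symmetric_matrix_def P_def transpose_add[of _ n n])
    have P_form: "v \<bullet> (P *\<^sub>v v) = v \<bullet> (P0 *\<^sub>v v) + \<epsilon> * (v \<bullet> (P1 *\<^sub>v v))" if "v \<in> carrier_vec n" for v
      using that Pc unfolding P_def
      by (simp add: add_mult_distrib_mat_vec[of _ n n] smult_mat_mult_vec[of _ n n] scalar_prod_add_distrib[of _ n])
    have "(\<Sum>t. ereal (?s t)) = ereal (x\<^sub>0 \<bullet> (P0 *\<^sub>v x\<^sub>0))"
      using P0_sums[OF x\<^sub>0] by (intro sums_unique[symmetric]) (simp add: sums_ereal)
    then have "x\<^sub>0 \<bullet> (P0 *\<^sub>v x\<^sub>0) < \<gamma>" using cost by simp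
    then have \<epsilon>: "0 < \<epsilon>" by (simp add: \<epsilon>_def)
    have P0_nonneg: "0 \<le> v \<bullet> (P0 *\<^sub>v v)" if "v \<in> carrier_vec n" for v
      using sums_le[OF _ sums_zero P0_sums[OF that]] S_nonneg traj[OF that] by simp
    \<comment> \<open>The first term of the series for the identity is \<open>v \<bullet> v\<close>;
      the remaining terms sum to the nonnegative value of the form at
      \<open>M *\<^sub>v v\<close>.\<close>
    have P1_ge: "v \<bullet> v \<le> v \<bullet> (P1 *\<^sub>v v)" if v: "v \<in> carrier_vec n" for v
    proof -
      have Mv: "M *\<^sub>v v \<in> carrier_vec n" using M v by simp
      have "0 \<le> w \<bullet> w" if "w \<in> carrier_vec n" for w :: "real vec"
        using that by (simp add: scalar_prod_def sum_nonneg)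
      then have "0 \<le> (M *\<^sub>v v) \<bullet> (P1 *\<^sub>v (M *\<^sub>v v))"
        using sums_le[OF _ sums_zero P1_sums[OF Mv]] traj[OF Mv] by simp
      then show ?thesis using stein[OF P1_sums v] v by simp
    qed
    have pos: "0 < v \<bullet> (P *\<^sub>v v)" if v: "v \<in> carrier_vec n" "v \<noteq> 0\<^sub>v n" for v
    proof -
      have "0 < v \<bullet> v" using v scalar_prod_self_pos_iff by blast
      then have "0 < \<epsilon> * (v \<bullet> (P1 *\<^sub>v v))" using P1_ge[OF v(1)] \<epsilon> by simp
      then show ?thesis using P0_nonneg[OF v(1)] P_form[OF v(1)] by simp
    qed
    have neg: "v \<bullet> ((M\<^sup>T * P * M - P + S) *\<^sub>v v) < 0" if v: "v \<in> carrier_vec n" "v \<noteq> 0\<^sub>v n" for v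
    proof -
      have Mv: "M *\<^sub>v v \<in> carrier_vec n" using M v by simp
      \<comment> \<open>The Stein equation of \<open>P0\<close> cancels \<open>S\<close>, and that
        of \<open>P1\<close> leaves the identity weighted by \<open>- \<epsilon>\<close>.\<close>
      have "v \<bullet> ((M\<^sup>T * P * M - P + S) *\<^sub>v v) = - \<epsilon> * (v \<bullet> v)"
        unfolding certificate_form[OF M Pc(3) Sc v(1)] P_form[OF v(1)] P_form[OF Mv]
        using stein[OF P0_sums v(1)] stein[OF P1_sums v(1)] v by (simp add: algebra_simps)
      moreover have "0 < v \<bullet> v" using v scalar_prod_self_pos_iff by blast
      ultimately show ?thesis using \<epsilon> by simp
    qed
    have "symmetric_matrix n (M\<^sup>T * P * M - P + S)"
      using symmetric_matrix_congruence[OF M P_sym] P_sym S_sym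
      by (auto simp: symmetric_matrix_def transpose_add[of _ n n] transpose_minus[of _ n n] minus_carrier_mat
          simp del: assoc_mult_mat)
    moreover have "x\<^sub>0 \<bullet> (P *\<^sub>v x\<^sub>0) < \<gamma>"
    proof -
      have "\<epsilon> * (x\<^sub>0 \<bullet> (P1 *\<^sub>v x\<^sub>0)) \<le> \<epsilon> * \<bar>x\<^sub>0 \<bullet> (P1 *\<^sub>v x\<^sub>0)\<bar>"
        using \<epsilon> by simp
      also have "\<dots> < \<epsilon> * (1 + \<bar>x\<^sub>0 \<bullet> (P1 *\<^sub>v x\<^sub>0)\<bar>)" using \<epsilon> by simp
      also have "\<dots> = \<gamma> - x\<^sub>0 \<bullet> (P0 *\<^sub>v x\<^sub>0)" unfolding \<epsilon>_def by simp
      finally show ?thesis using P_form[OF x\<^sub>0] by simp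
    qed
    ultimately show "\<exists>P. positive_definite n P \<and> negative_definite n (M\<^sup>T * P * M - P + S) \<and> x\<^sub>0 \<bullet> (P *\<^sub>v x\<^sub>0) < \<gamma>"
      using P_sym pos neg by (auto simp: positive_definite_def negative_definite_def)
  qed
qed

section \<open>Suboptimal gains of a single system\<close>

text \<open>Under the feedback \<open>K\<close> the stage cost becomes a single quadratic form in
  the state.\<close>

lemma quadratic_form_add_congruence:
  fixes R :: "real mat"
  assumes K: "K \<in> carrier_mat m n" and R: "R \<in> carrier_mat m m" and Q: "Q \<in> carrier_mat n n"
    and v: "v \<in> carrier_vec n"
  shows "v \<bullet> ((Q + K\<^sup>T * R * K) *\<^sub>v v) = v \<bullet> (Q *\<^sub>v v) + (K *\<^sub>v v) \<bullet> (R *\<^sub>v (K *\<^sub>v v))"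
proof -
  have KRK: "K\<^sup>T * R * K \<in> carrier_mat n n" using K R by auto
  show ?thesis
    unfolding add_mult_distrib_mat_vec[OF Q KRK v] congruence_form[OF K R v v, symmetric]
    by (rule scalar_prod_add_distrib[OF v mult_mat_vec_carrier[OF Q v] mult_mat_vec_carrier[OF KRK v]])
qed

lemma positive_semidefinite_add_congruence:
  assumes Q: "positive_semidefinite n Q" and R: "positive_definite m R" and K: "K \<in> carrier_mat m n"
  shows "positive_semidefinite n (Q + K\<^sup>T * R * K)"
proof -
  have Rc: "R \<in> carrier_mat m m" "symmetric_matrix m R"
    and R_pos: "\<And>u. u \<in> carrier_vec m \<Longrightarrow> u \<noteq> 0\<^sub>v m \<Longrightarrow> 0 < u \<bullet> (R *\<^sub>v u)"
    using R by (auto simp: positive_definite_def symmetric_matrix_def)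
  have R_nonneg: "0 \<le> u \<bullet> (R *\<^sub>v u)" if "u \<in> carrier_vec m" for u
    using R_pos[OF that] Rc by (cases "u = 0\<^sub>v m") auto
  have Qc: "Q \<in> carrier_mat n n" and "symmetric_matrix n Q"
    using Q by (auto simp: positive_semidefinite_def symmetric_matrix_def)
  then have "symmetric_matrix n (Q + K\<^sup>T * R * K)"
    using symmetric_matrix_congruence[OF K Rc(2)]
    by (auto simp: symmetric_matrix_def transpose_add[of _ n n] simp del: assoc_mult_mat)
  moreover have "0 \<le> v \<bullet> ((Q + K\<^sup>T * R * K) *\<^sub>v v)" if v: "v \<in> carrier_vec n" for v
    unfolding quadratic_form_add_congruence[OF K Rc(1) Qc v]
    using Q R_nonneg[of "K *\<^sub>v v"] K v by (auto simp: positive_semidefinite_def)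
  ultimately show ?thesis by (simp add: positive_semidefinite_def)
qed


lemma closed_loop_eq_pow:
  assumes A: "A \<in> carrier_mat n n" and B: "B \<in> carrier_mat n m" and K: "K \<in> carrier_mat m n"
    and x\<^sub>0: "x\<^sub>0 \<in> carrier_vec n"
  shows "closed_loop A B K x\<^sub>0 t = (A + B * K) ^\<^sub>m t *\<^sub>v x\<^sub>0"
proof -
  have M: "A + B * K \<in> carrier_mat n n" using A B K by auto
  show ?thesis
  proof (induction t)
    case 0
    show ?case using carrier_matD(1)[OF M] x\<^sub>0 by simp
  next
    case (Suc t)
    then show ?case by (simp add: pow_mat_Suc_mult_vec'[OF M x\<^sub>0] del: pow_mat.simps)
  qed
qed

text \<open>The closed loop is autonomous with matrix \<open>A + B * K\<close> and stage weight
  \<open>Q + K\<^sup>T * R * K\<close>, so the criterion for a single matrix applies.\<close>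

lemma suboptimal_gain_iff_certificate:
  assumes A: "A \<in> carrier_mat n n" and B: "B \<in> carrier_mat n m" and K: "K \<in> carrier_mat m n"
    and Q: "positive_semidefinite n Q" and R: "positive_definite m R" and x\<^sub>0: "x\<^sub>0 \<in> carrier_vec n"
  shows "suboptimal_gain Q R x\<^sub>0 \<gamma> A B K \<longleftrightarrow>
    (\<exists>P. positive_definite n P \<and>
       negative_definite n ((A + B * K)\<^sup>T * P * (A + B * K) - P + Q + K\<^sup>T * R * K) \<and>
       x\<^sub>0 \<bullet> (P *\<^sub>v x\<^sub>0) < \<gamma>)"
proof -
  let ?M = "A + B * K" and ?S = "Q + K\<^sup>T * R * K"
  have M: "?M \<in> carrier_mat n n" using A B K by auto
  have Rc: "R \<in> carrier_mat m m" and Qc: "Q \<in> carrier_mat n n"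
    using Q R by (auto simp: positive_definite_def positive_semidefinite_def symmetric_matrix_def)
  have KRK: "K\<^sup>T * R * K \<in> carrier_mat n n" using K Rc by auto
  have "lq_cost Q R A B x\<^sub>0 K = (\<Sum>t. ereal ((?M ^\<^sub>m t *\<^sub>v x\<^sub>0) \<bullet> (?S *\<^sub>v (?M ^\<^sub>m t *\<^sub>v x\<^sub>0))))"
    unfolding lq_cost_def Let_def closed_loop_eq_pow[OF A B K x\<^sub>0]
    using quadratic_form_add_congruence[OF K Rc Qc mult_mat_vec_carrier[OF pow_carrier_mat[OF M] x\<^sub>0]]
    by simp
  then have "suboptimal_gain Q R x\<^sub>0 \<gamma> A B K \<longleftrightarrow>
      (\<exists>P. positive_definite n P \<and> negative_definite n (?M\<^sup>T * P * ?M - P + ?S) \<and> x\<^sub>0 \<bullet> (P *\<^sub>v x\<^sub>0) < \<gamma>)"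
    using stable_and_cost_less_iff_certificate[OF M positive_semidefinite_add_congruence[OF Q R K] x\<^sub>0]
      carrier_matD[OF A] carrier_matD[OF B] K
    by (simp add: suboptimal_gain_def)
  also have "\<dots> \<longleftrightarrow> (\<exists>P. positive_definite n P \<and>
      negative_definite n (?M\<^sup>T * P * ?M - P + Q + K\<^sup>T * R * K) \<and> x\<^sub>0 \<bullet> (P *\<^sub>v x\<^sub>0) < \<gamma>)"
  \<comment> \<open>The two sides differ only in bracketing: the weight is grouped as one matrix on
    the left and added summand by summand on the right.\<close>
  proof (intro ex_cong1 conj_cong refl)
    fix P assume "positive_definite n P"
    then have "P \<in> carrier_mat n n" by (simp add: positive_definite_def symmetric_matrix_def)
    then have "?M\<^sup>T * P * ?M - P \<in> carrier_mat n n" using M by (intro minus_carrier_mat)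
    from assoc_add_mat[OF this Qc KRK]
    show "negative_definite n (?M\<^sup>T * P * ?M - P + ?S) =
        negative_definite n (?M\<^sup>T * P * ?M - P + Q + K\<^sup>T * R * K)" by simp
  qed
  finally show ?thesis .
qed

section \<open>Gains that stabilize every system explaining the data\<close>

text \<open>A left annihilator \<open>(\<xi>, \<eta>)\<close> of the data allows the perturbation \<open>(w \<xi>\<^sup>T, w \<eta>\<^sup>T)\<close> of the
  system for every \<open>w\<close>. If \<open>\<zeta> = \<xi> + K\<^sup>T \<eta>\<close> were nonzero, a suitable \<open>w\<close> would make \<open>\<zeta>\<close> an
  eigenvector of the closed loop with eigenvalue 2.\<close>

lemma stabilizing_gain_left_kernel:
  fixes X\<^sub>m U K :: "real mat"
  assumes Xm: "X\<^sub>m \<in> carrier_mat n T" and U: "U \<in> carrier_mat m T" and K: "K \<in> carrier_mat m n"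
    and A: "A \<in> carrier_mat n n" and B: "B \<in> carrier_mat n m"
    and stable: "\<And>A' B'. A' \<in> carrier_mat n n \<Longrightarrow> B' \<in> carrier_mat n m \<Longrightarrow>
       A' * X\<^sub>m + B' * U = A * X\<^sub>m + B * U \<Longrightarrow> stable (A' + B' * K)"
    and \<xi>: "\<xi> \<in> carrier_vec n" and \<eta>: "\<eta> \<in> carrier_vec m"
    and ker: "\<And>y. y \<in> carrier_vec T \<Longrightarrow> \<xi> \<bullet> (X\<^sub>m *\<^sub>v y) + \<eta> \<bullet> (U *\<^sub>v y) = 0"
    and z: "z \<in> carrier_vec n"
  shows "\<xi> \<bullet> z + \<eta> \<bullet> (K *\<^sub>v z) = 0"
proof -
  have KT: "K\<^sup>T \<in> carrier_mat n m" using K by simp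
  \<comment> \<open>\<open>\<zeta>\<close> represents the linear functional of the conclusion as a
    scalar product, so it remains to show that \<open>\<zeta>\<close> vanishes.\<close>
  define \<zeta> where "\<zeta> = \<xi> + K\<^sup>T *\<^sub>v \<eta>"
  have \<zeta>: "\<zeta> \<in> carrier_vec n" using \<xi> KT \<eta> by (simp add: \<zeta>_def)
  have \<zeta>_prod: "\<zeta> \<bullet> v = \<xi> \<bullet> v + \<eta> \<bullet> (K *\<^sub>v v)" if "v \<in> carrier_vec n" for v
    unfolding \<zeta>_def using that \<xi> KT \<eta> transpose_vec_mult_scalar[OF K that \<eta>]
    by (simp add: add_scalar_prod_distrib[of _ n])
  have "\<zeta> = 0\<^sub>v n"
  proof (rule ccontr)
    assume nz: "\<zeta> \<noteq> 0\<^sub>v n"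
    then have pos: "0 < \<zeta> \<bullet> \<zeta>" using scalar_prod_self_pos_iff[OF \<zeta>] by simp
    let ?M = "A + B * K"
    have M: "?M \<in> carrier_mat n n" using A B K by auto
    \<comment> \<open>The solution of \<open>?M *\<^sub>v \<zeta> + (\<zeta> \<bullet> \<zeta>)
      \<cdot>\<^sub>v w = 2 \<cdot>\<^sub>v \<zeta>\<close>; any factor of modulus at least 1 could
      replace 2.\<close>
    define w where "w = (1 / (\<zeta> \<bullet> \<zeta>)) \<cdot>\<^sub>v (2 \<cdot>\<^sub>v \<zeta> - ?M *\<^sub>v \<zeta>)"
    have w: "w \<in> carrier_vec n"
      using \<zeta> mult_mat_vec_carrier[OF M \<zeta>] by (simp add: w_def minus_carrier_vec)
    \<comment> \<open>The rank-one matrix \<open>w v\<^sup>T\<close>; its number of columns is read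
      off from \<open>v\<close>, so that it perturbs both \<open>A\<close> and
      \<open>B\<close>.\<close>
    define outer where "outer v = mat n (dim_vec v) (\<lambda>(i, j). w $ i * v $ j)" for v
    have outer: "outer v \<in> carrier_mat n k" if "v \<in> carrier_vec k" for v k
      using that by (simp add: outer_def)
    have outer_mult: "outer v *\<^sub>v y = (v \<bullet> y) \<cdot>\<^sub>v w" if "v \<in> carrier_vec k" "y \<in> carrier_vec k" for v y k
      using that w
      by (intro eq_vecI) (auto simp: outer_def scalar_prod_def sum_distrib_left sum_distrib_right mult_ac)
    have O1: "outer \<xi> \<in> carrier_mat n n" and O2: "outer \<eta> \<in> carrier_mat n m"
      using outer \<xi> \<eta> by auto
    have "stable ((A + outer \<xi>) + (B + outer \<eta>) * K)"
    proof (rule stable)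
      \<comment> \<open>The perturbation is invisible in the data: it changes data column
        \<open>j\<close> by \<open>w\<close> scaled with the annihilator applied to that column,
        which is 0.\<close>
      have "col (outer \<xi> * X\<^sub>m + outer \<eta> * U) j = 0\<^sub>v n" if j: "j < T" for j
      proof -
        let ?e = "unit_vec T j :: real vec"
        have e: "X\<^sub>m *\<^sub>v ?e = col X\<^sub>m j" "U *\<^sub>v ?e = col U j"
          by (rule mult_mat_unit_vec[OF Xm j], rule mult_mat_unit_vec[OF U j])
        have "col (outer \<xi> * X\<^sub>m + outer \<eta> * U) j = col (outer \<xi> * X\<^sub>m) j + col (outer \<eta> * U) j"
          using O1 O2 Xm U j by (intro col_add) auto
        also have "\<dots> = (\<xi> \<bullet> col X\<^sub>m j) \<cdot>\<^sub>v w + (\<eta> \<bullet> col U j) \<cdot>\<^sub>v w"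
        proof -
          have "col X\<^sub>m j \<in> carrier_vec n" "col U j \<in> carrier_vec m" using Xm U j by auto
          then show ?thesis
            unfolding col_mult2[OF O1 Xm j] col_mult2[OF O2 U j]
            by (simp only: outer_mult[OF \<xi>] outer_mult[OF \<eta>])
        qed
        also have "\<dots> = (\<xi> \<bullet> (X\<^sub>m *\<^sub>v ?e) + \<eta> \<bullet> (U *\<^sub>v ?e)) \<cdot>\<^sub>v w"
          unfolding e by (simp add: add_smult_distrib_vec)
        also have "\<dots> = 0\<^sub>v n" unfolding ker[OF unit_vec_carrier] using w by (intro eq_vecI) auto
        finally show ?thesis .
      qed
      then have zero: "outer \<xi> * X\<^sub>m + outer \<eta> * U = 0\<^sub>m n T"
        using Xm U O1 O2 by (intro mat_col_eqI) auto
      have prods: "A * X\<^sub>m \<in> carrier_mat n T" "B * U \<in> carrier_mat n T"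
          "outer \<xi> * X\<^sub>m \<in> carrier_mat n T" "outer \<eta> * U \<in> carrier_mat n T"
        using A B Xm U O1 O2 by auto
      have "(A + outer \<xi>) * X\<^sub>m + (B + outer \<eta>) * U = (A * X\<^sub>m + outer \<xi> * X\<^sub>m) + (B * U + outer \<eta> * U)"
        by (simp only: add_mult_distrib_mat[OF A O1 Xm] add_mult_distrib_mat[OF B O2 U])
      also have "\<dots> = (A * X\<^sub>m + B * U) + (outer \<xi> * X\<^sub>m + outer \<eta> * U)"
        using prods by (intro eq_matI) auto
      also have "\<dots> = A * X\<^sub>m + B * U" unfolding zero using prods by simp
      finally show "(A + outer \<xi>) * X\<^sub>m + (B + outer \<eta>) * U = A * X\<^sub>m + B * U" .
    qed (use A B O1 O2 in auto)
    \<comment> \<open>The perturbation adds to the closed-loop image of \<open>\<zeta>\<close> the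
      vector \<open>w\<close> with coefficient \<open>\<xi> \<bullet> \<zeta> + \<eta> \<bullet> (K
      *\<^sub>v \<zeta>)\<close>, which is \<open>\<zeta> \<bullet> \<zeta>\<close>.\<close>
    moreover have "((A + outer \<xi>) + (B + outer \<eta>) * K) *\<^sub>v \<zeta> = 2 \<cdot>\<^sub>v \<zeta>"
    proof -
      have K\<zeta>: "K *\<^sub>v \<zeta> \<in> carrier_vec m" using K \<zeta> by simp
      have BK: "B * K \<in> carrier_mat n n" "(B + outer \<eta>) * K \<in> carrier_mat n n" "A + outer \<xi> \<in> carrier_mat n n"
          "B + outer \<eta> \<in> carrier_mat n m"
        using A B K O1 O2 by auto
      have vecs: "A *\<^sub>v \<zeta> \<in> carrier_vec n" "B *\<^sub>v (K *\<^sub>v \<zeta>) \<in> carrier_vec n"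
        using A B \<zeta> K\<zeta> by auto
      have M\<zeta>: "?M *\<^sub>v \<zeta> = A *\<^sub>v \<zeta> + B *\<^sub>v (K *\<^sub>v \<zeta>)"
        by (simp add: add_mult_distrib_mat_vec[OF A BK(1) \<zeta>] assoc_mult_mat_vec[OF B K \<zeta>])
      have "((A + outer \<xi>) + (B + outer \<eta>) * K) *\<^sub>v \<zeta> =
          (A *\<^sub>v \<zeta> + (\<xi> \<bullet> \<zeta>) \<cdot>\<^sub>v w) + (B *\<^sub>v (K *\<^sub>v \<zeta>) + (\<eta> \<bullet> (K *\<^sub>v \<zeta>)) \<cdot>\<^sub>v w)"
        by (simp only: add_mult_distrib_mat_vec[OF BK(3,2) \<zeta>] add_mult_distrib_mat_vec[OF A O1 \<zeta>]
            assoc_mult_mat_vec[OF BK(4) K \<zeta>] add_mult_distrib_mat_vec[OF B O2 K\<zeta>]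
            outer_mult[OF \<xi> \<zeta>] outer_mult[OF \<eta> K\<zeta>])
      also have "\<dots> = ?M *\<^sub>v \<zeta> + (\<zeta> \<bullet> \<zeta>) \<cdot>\<^sub>v w"
        unfolding M\<zeta> \<zeta>_prod[OF \<zeta>] using vecs w by (intro eq_vecI) (auto simp: algebra_simps simp del: index_mult_mat_vec)
      also have "(\<zeta> \<bullet> \<zeta>) \<cdot>\<^sub>v w = 2 \<cdot>\<^sub>v \<zeta> - ?M *\<^sub>v \<zeta>"
        unfolding w_def smult_smult_assoc using pos by simp
      also have "?M *\<^sub>v \<zeta> + (2 \<cdot>\<^sub>v \<zeta> - ?M *\<^sub>v \<zeta>) = 2 \<cdot>\<^sub>v \<zeta>"
      proof -
        have "p + (q - p) = q" if "p \<in> carrier_vec n" "q \<in> carrier_vec n" for p q :: "real vec"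
          using that by (intro eq_vecI) auto
        from this[OF mult_mat_vec_carrier[OF M \<zeta>], of "2 \<cdot>\<^sub>v \<zeta>"] show ?thesis using \<zeta> by simp
      qed
      finally show ?thesis .
    qed
    moreover have "(A + outer \<xi>) + (B + outer \<eta>) * K \<in> carrier_mat n n"
      using A B K O1 O2 by auto
    ultimately have "\<bar>2 :: real\<bar> < 1"
      using stable_eigenvector_bound \<zeta> nz by blast
    then show False by simp
  qed
  then show ?thesis using \<zeta>_prod[OF z] z by simp
qed

text \<open>The two conditions on \<open>Y\<close> form one equation with coefficient matrix
  \<open>X\<^sub>m @\<^sub>r U\<close> and right side \<open>1\<^sub>m n @\<^sub>r K\<close>.
  Stability makes every left annihilator of the former annihilate the latter, so the equation is
  solvable.\<close>

lemma stabilizing_gain_data_form: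
  fixes X\<^sub>m U K :: "real mat"
  assumes Xm: "X\<^sub>m \<in> carrier_mat n T" and U: "U \<in> carrier_mat m T" and K: "K \<in> carrier_mat m n"
    and A: "A \<in> carrier_mat n n" and B: "B \<in> carrier_mat n m"
    and stable: "\<And>A' B'. A' \<in> carrier_mat n n \<Longrightarrow> B' \<in> carrier_mat n m \<Longrightarrow>
       A' * X\<^sub>m + B' * U = A * X\<^sub>m + B * U \<Longrightarrow> stable (A' + B' * K)"
  obtains Y where "Y \<in> carrier_mat T n" "X\<^sub>m * Y = 1\<^sub>m n" "U * Y = K"
proof -
  have one: "1\<^sub>m n \<in> carrier_mat n n" by simp
  have W: "X\<^sub>m @\<^sub>r U \<in> carrier_mat (n + m) T" using Xm U by auto
  have G: "1\<^sub>m n @\<^sub>r K \<in> carrier_mat (n + m) n" using one K by blast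
  have "r \<bullet> ((1\<^sub>m n @\<^sub>r K) *\<^sub>v z) = 0"
    if r: "r \<in> carrier_vec (n + m)" and ker: "\<And>y. y \<in> carrier_vec T \<Longrightarrow> r \<bullet> ((X\<^sub>m @\<^sub>r U) *\<^sub>v y) = 0"
      and z: "z \<in> carrier_vec n" for r z
  proof -
    define \<xi> where "\<xi> = vec_first r n"
    define \<eta> where "\<eta> = vec_last r m"
    have \<xi>\<eta>: "\<xi> \<in> carrier_vec n" "\<eta> \<in> carrier_vec m" by (auto simp: \<xi>_def \<eta>_def)
    have r_eq: "r = \<xi> @\<^sub>v \<eta>" using r by (simp add: \<xi>_def \<eta>_def)
    have "\<xi> \<bullet> (X\<^sub>m *\<^sub>v y) + \<eta> \<bullet> (U *\<^sub>v y) = 0" if y: "y \<in> carrier_vec T" for y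
      using ker[OF y] unfolding r_eq mat_mult_append[OF Xm U y]
        scalar_prod_append[OF \<xi>\<eta> mult_mat_vec_carrier[OF Xm y] mult_mat_vec_carrier[OF U y]] .
    from stabilizing_gain_left_kernel[OF Xm U K A B stable \<xi>\<eta> this z]
    have "\<xi> \<bullet> z + \<eta> \<bullet> (K *\<^sub>v z) = 0" by blast
    then show ?thesis
      unfolding r_eq mat_mult_append[OF one K z]
        scalar_prod_append[OF \<xi>\<eta> mult_mat_vec_carrier[OF one z] mult_mat_vec_carrier[OF K z]]
      using z by simp
  qed
  from mat_mult_solvable_if_left_kernel_subset[OF W G this]
  obtain Y where Y: "Y \<in> carrier_mat T n" "(X\<^sub>m @\<^sub>r U) * Y = 1\<^sub>m n @\<^sub>r K" by blast
  \<comment> \<open>The blocks of the stacked equation are separated after application to a vector,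
    where both sides become appended vectors of matching lengths.\<close>
  have "X\<^sub>m *\<^sub>v (Y *\<^sub>v z) = z \<and> U *\<^sub>v (Y *\<^sub>v z) = K *\<^sub>v z" if z: "z \<in> carrier_vec n" for z
  proof -
    have Yz: "Y *\<^sub>v z \<in> carrier_vec T" using Y(1) z by simp
    have "(X\<^sub>m *\<^sub>v (Y *\<^sub>v z)) @\<^sub>v (U *\<^sub>v (Y *\<^sub>v z)) = z @\<^sub>v (K *\<^sub>v z)"
      using arg_cong[OF Y(2), of "\<lambda>H. H *\<^sub>v z"] z
      unfolding assoc_mult_mat_vec[OF W Y(1) z] mat_mult_append[OF Xm U Yz] mat_mult_append[OF one K z]
      by simp
    then show ?thesis
      using append_vec_eq[OF mult_mat_vec_carrier[OF Xm Yz] z] by blast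
  qed
  note vec_eq = this[THEN conjunct1] this[THEN conjunct2]
  have ext: "F = H" if "F \<in> carrier_mat k n" "H \<in> carrier_mat k n"
    "\<And>z. z \<in> carrier_vec n \<Longrightarrow> F *\<^sub>v z = H *\<^sub>v z" for F H :: "real mat" and k
  proof (rule mat_col_eqI)
    fix j assume "j < dim_col H"
    then have "j < n" using that by simp
    then have "F *\<^sub>v unit_vec n j = col F j" "H *\<^sub>v unit_vec n j = col H j"
      using that(1,2) by (auto intro!: mult_mat_unit_vec)
    then show "col F j = col H j" using that(3)[of "unit_vec n j"] by simp
  qed (use that in auto)
  have "X\<^sub>m * Y = 1\<^sub>m n"
    using vec_eq(1) assoc_mult_mat_vec[OF Xm Y(1)] Xm Y(1) by (intro ext[of _ n]) auto
  moreover have "U * Y = K"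
    using vec_eq(2) assoc_mult_mat_vec[OF U Y(1)] U Y(1) K by (intro ext[of _ m]) auto
  ultimately show ?thesis using that Y(1) by blast
qed

section \<open>Characterization of informativity and of the suboptimal gains\<close>

theorem theorem9:
  fixes n m T :: nat
    and A\<^sub>s B\<^sub>s Q R U X :: "real mat"
    and x u :: "nat \<Rightarrow> real vec"
    and x\<^sub>0 :: "real vec"
    and \<gamma> :: real
  assumes "A\<^sub>s \<in> carrier_mat n n"
    and "B\<^sub>s \<in> carrier_mat n m"
    and "\<And>t. t \<le> T \<Longrightarrow> x t \<in> carrier_vec n"
    and "\<And>t. t < T \<Longrightarrow> u t \<in> carrier_vec m"
    and "\<And>t. t < T \<Longrightarrow> x (t + 1) = A\<^sub>s *\<^sub>v x t + B\<^sub>s *\<^sub>v u t"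
    and "U = input_data m T u"
    and "X = state_data n T x"
    and "positive_semidefinite n Q"
    and "positive_definite m R"
    and "x\<^sub>0 \<in> carrier_vec n"
    and "0 < \<gamma>"
  shows "(informative_suboptimal_LQR Q R x\<^sub>0 \<gamma> U X \<longleftrightarrow>
           (\<exists>P Y. positive_definite n P \<and> right_inverse_mat (past_states X) Y \<and>
                  LQR_inequalities Q R x\<^sub>0 \<gamma> U X P Y))
       \<and> (\<forall>K \<in> carrier_mat m n.
           (\<forall>(A, B) \<in> explaining_systems U X. suboptimal_gain Q R x\<^sub>0 \<gamma> A B K) \<longleftrightarrow>
           (\<exists>Y. right_inverse_mat (past_states X) Y \<and> K = U * Y \<and>
                (\<exists>P. positive_definite n P \<and> LQR_inequalities Q R x\<^sub>0 \<gamma> U X P Y)))"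
proof -
  note A\<^sub>s = assms(1) and B\<^sub>s = assms(2) and Q = assms(8) and R = assms(9) and x\<^sub>0 = assms(10)
  let ?Xm = "past_states X" and ?Xp = "future_states X"
  have U: "U \<in> carrier_mat m T" unfolding assms(6) input_data_def by (simp add: carrier_matI)
  have X: "X \<in> carrier_mat n (T + 1)" unfolding assms(7) state_data_def by (simp add: carrier_matI)
  have Xm: "?Xm \<in> carrier_mat n T" and Xp: "?Xp \<in> carrier_mat n T"
    using X by (auto simp: past_states_def future_states_def)
  \<comment> \<open>\<open>X\<close> has \<open>T + 1\<close> columns; dropping the last or the
    first leaves \<open>T\<close>, and the second choice shifts the sample index by one.\<close>
  have cols: "col ?Xm t = x t" "col ?Xp t = x (t + 1)" "col U t = u t" if "t < T" for t
  proof -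
    have X_entry: "X $$ (i, k) = x k $ i" if "i < n" "k \<le> T" for i k
      using that unfolding assms(7) state_data_def by (simp add: mat_of_cols_index del: upt_Suc)
    show "col ?Xm t = x t" "col ?Xp t = x (t + 1)"
      using that X assms(3)[of t] assms(3)[of "t + 1"]
      by (auto intro!: eq_vecI simp: past_states_def future_states_def X_entry)
    show "col U t = u t"
      using that assms(4) unfolding assms(6) input_data_def by simp
  qed
  have data: "?Xp = A\<^sub>s * ?Xm + B\<^sub>s * U"
  proof (rule mat_col_eqI)
    fix t assume "t < dim_col (A\<^sub>s * ?Xm + B\<^sub>s * U)"
    then have t: "t < T" using U by simp
    have "col (A\<^sub>s * ?Xm + B\<^sub>s * U) t = col (A\<^sub>s * ?Xm) t + col (B\<^sub>s * U) t"
      using A\<^sub>s B\<^sub>s Xm U t by (intro col_add) auto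
    then show "col ?Xp t = col (A\<^sub>s * ?Xm + B\<^sub>s * U) t"
      by (simp only: assms(5)[OF t] cols[OF t] col_mult2[OF A\<^sub>s Xm t] col_mult2[OF B\<^sub>s U t])
  qed (use A\<^sub>s B\<^sub>s Xm Xp U in auto)
  have explaining: "(A, B) \<in> explaining_systems U X \<longleftrightarrow>
      A \<in> carrier_mat n n \<and> B \<in> carrier_mat n m \<and> ?Xp = A * ?Xm + B * U" for A B
    using X U by (auto simp: explaining_systems_def)
  have right_inverse: "right_inverse_mat ?Xm Y \<longleftrightarrow> Y \<in> carrier_mat T n \<and> ?Xm * Y = 1\<^sub>m n" for Y
    using Xm by (auto simp: right_inverse_mat_def inverts_mat_def)
  \<comment> \<open>Multiplying the data equation from the right by a right inverse of
    \<open>?Xm\<close> shows that all explaining systems share one closed loop.\<close>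
  have closed_loop: "A + B * (U * Y) = ?Xp * Y"
    if "(A, B) \<in> explaining_systems U X" "right_inverse_mat ?Xm Y" for A B Y
  proof -
    have AB: "A \<in> carrier_mat n n" "B \<in> carrier_mat n m" "?Xp = A * ?Xm + B * U"
      and Y: "Y \<in> carrier_mat T n" "?Xm * Y = 1\<^sub>m n"
      using that by (auto simp: explaining right_inverse)
    have "A * ?Xm \<in> carrier_mat n T" "B * U \<in> carrier_mat n T" using AB Xm U by auto
    then have "?Xp * Y = (A * ?Xm) * Y + (B * U) * Y"
      unfolding AB(3) using Y(1) by (rule add_mult_distrib_mat)
    also have "(A * ?Xm) * Y = A"
      unfolding assoc_mult_mat[OF AB(1) Xm Y(1)] Y(2) using AB(1) by simp
    also have "(B * U) * Y = B * (U * Y)" by (rule assoc_mult_mat[OF AB(2) U Y(1)])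
    finally show ?thesis by simp
  qed
  \<comment> \<open>The right side mentions neither \<open>A\<close> nor \<open>B\<close>, so
    suboptimality of \<open>U * Y\<close> for one explaining system carries over to all of
    them.\<close>
  have certificate: "suboptimal_gain Q R x\<^sub>0 \<gamma> A B (U * Y) \<longleftrightarrow>
      (\<exists>P. positive_definite n P \<and> LQR_inequalities Q R x\<^sub>0 \<gamma> U X P Y)"
    if AB: "(A, B) \<in> explaining_systems U X" and Y: "right_inverse_mat ?Xm Y" for A B Y
  proof -
    have "U * Y \<in> carrier_mat m n" using U Y by (auto simp: right_inverse)
    then show ?thesis
      using suboptimal_gain_iff_certificate[OF _ _ _ Q R x\<^sub>0, of A B "U * Y" \<gamma>] AB X
      by (simp add: LQR_inequalities_def closed_loop[OF AB Y] explaining)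
  qed
  \<comment> \<open>The true system makes the explaining set nonempty, so the universal condition on
    a gain has an instance.\<close>
  have true_system: "(A\<^sub>s, B\<^sub>s) \<in> explaining_systems U X"
    using A\<^sub>s B\<^sub>s data by (simp add: explaining)
  have gains: "(\<forall>(A, B) \<in> explaining_systems U X. suboptimal_gain Q R x\<^sub>0 \<gamma> A B K) \<longleftrightarrow>
      (\<exists>Y. right_inverse_mat ?Xm Y \<and> K = U * Y \<and>
         (\<exists>P. positive_definite n P \<and> LQR_inequalities Q R x\<^sub>0 \<gamma> U X P Y))" (is "?L \<longleftrightarrow> ?R")
    if K: "K \<in> carrier_mat m n" for K
  proof
    assume L: ?L
    \<comment> \<open>Stability for all explaining systems yields \<open>Y\<close>; the cost bound
      enters afterwards, through \<open>certificate\<close> at the true system.\<close>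
    have "stable (A + B * K)"
      if "A \<in> carrier_mat n n" "B \<in> carrier_mat n m" "A * ?Xm + B * U = A\<^sub>s * ?Xm + B\<^sub>s * U" for A B
      using L that data by (auto simp: explaining suboptimal_gain_def)
    then obtain Y where Y: "Y \<in> carrier_mat T n" "?Xm * Y = 1\<^sub>m n" "U * Y = K"
      using stabilizing_gain_data_form[OF Xm U K A\<^sub>s B\<^sub>s] by blast
    then show ?R
      using certificate[OF true_system, of Y] L true_system by (auto simp: right_inverse)
  next
    assume ?R
    then show ?L using certificate by blast
  qed
  have "informative_suboptimal_LQR Q R x\<^sub>0 \<gamma> U X \<longleftrightarrow>
      (\<exists>K \<in> carrier_mat m n. \<forall>(A, B) \<in> explaining_systems U X. suboptimal_gain Q R x\<^sub>0 \<gamma> A B K)"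
    using U X by (simp add: informative_suboptimal_LQR_def)
  also have "\<dots> \<longleftrightarrow> (\<exists>P Y. positive_definite n P \<and> right_inverse_mat ?Xm Y \<and>
      LQR_inequalities Q R x\<^sub>0 \<gamma> U X P Y)"
  proof -
    \<comment> \<open>From a pair \<open>P\<close>, \<open>Y\<close> the gain is recovered as
      \<open>U * Y\<close>; its dimensions place it in the range of the quantifier over
      \<open>K\<close>.\<close>
    have "U * Y \<in> carrier_mat m n" if "right_inverse_mat ?Xm Y" for Y
      using that U by (auto simp: right_inverse)
    then show ?thesis using gains by blast
  qed
  finally show ?thesis using gains by blast
qed

end
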